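(* The following hold in the algebra $\mathbb{T}$. (1) $\mathrm{Ann}_{\mathbb{T}}(\mathbb{D})=\mathbb{G}$ and $\mathrm{Ann}_{\mathbb{T}}(\mathbb{G})=\mathbb{D}$. (2) An element $\mathbf{y}\in\mathbb{T}$ is a zero divisor in $\mathbb{T}$ if and only if $\mathbf{y}\in\mathbb{D}$ or $\mathbf{y}\in\mathbb{G}$. (3) An element $\mathbf{x}\in\mathbb{T}$ is invertible in $\mathbb{T}$ if and only if there exist $a,b,c\in\mathbb{R}$ such that $$\mathbf{x}=a(1,1,0)+b(-1,0,1)+c(1,-1,1),$$ where $a^2+b^2>0$ and $c^2>0$.
   Context: $\mathbb{T}$ denotes the real vector space $\mathbb{R}^3$ with basis $\mathbf{1}_{\mathbb{T}}=(1,0,0)$, $\mathbf{u}=(0,1,0)$, $\mathbf{v}=(0,0,1)$ and multiplication $$(X_1,X_u,X_v)\otimes(Y_1,Y_u,Y_v)=\big(X_1Y_1-X_uY_v-X_vY_u,\; X_1Y_u+X_uY_1-X_vY_v,\; X_1Y_v+X_uY_u+X_vY_1\big).$$ It is a commutative associative real algebra with identity $\mathbf{1}_{\mathbb{T}}$. For $\mathbf{x}=(X_1,X_u,X_v)$ put $A(\mathbf{x})=X_1^2+X_u^2+X_v^2$ and $B(\mathbf{x})=X_1X_u+X_uX_v-X_vX_1$. Then $$\mathbb{D}=\{\Gamma\in\mathbb{T}\mid A(\Gamma)+B(\Gamma)=0\}$$ (equivalently $\mathbb{D}=\{(\gamma,-\gamma,\gamma)\mid\gamma\in\mathbb{R}\}$),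 and $$\mathbb{G}=\{(\alpha-\beta,\alpha,\beta)\mid\alpha,\beta\in\mathbb{R}\}.$$ For an algebra $\mathbb{A}$ and $S\subset\mathbb{A}$, the annihilator $\mathrm{Ann}_{\mathbb{A}}(S)$ is the set of all $a\in\mathbb{A}$ with $a\cdot s=0$ for all $s\in S$. An element $\mathbf{y}$ is a zero divisor if there is a nonzero $\mathbf{z}\in\mathbb{T}$ with $\mathbf{y}\otimes\mathbf{z}=0$; in particular $0$ counts as a zero divisor. *)

theory Defs
  imports Complex_Main
begin

text \<open>
  The algebra T is set up like the library's complex numbers: a type of coordinate triples with
  the vector space structure of R^3, so that \<open>*\<close> can denote the product of T (on the library's
  product and vector types it is undefined or componentwise) and the notions of the type-class
  hierarchy apply. \<open>TNum X1 Xu Xv\<close> is the vector (X1, Xu, Xv).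
\<close>

datatype tnum = TNum (c1: real) (cu: real) (cv: real)

lemma tnum_eq_iff: "x = y \<longleftrightarrow> c1 x = c1 y \<and> cu x = cu y \<and> cv x = cv y"
  by (cases x; cases y) simp

instantiation tnum :: real_vector
begin

definition zero_tnum :: tnum
  where "0 = TNum 0 0 0"

definition plus_tnum :: "tnum \<Rightarrow> tnum \<Rightarrow> tnum"
  where "x + y = TNum (c1 x + c1 y) (cu x + cu y) (cv x + cv y)"

definition uminus_tnum :: "tnum \<Rightarrow> tnum"
  where "- x = TNum (- c1 x) (- cu x) (- cv x)"

definition minus_tnum :: "tnum \<Rightarrow> tnum \<Rightarrow> tnum"
  where "x - y = TNum (c1 x - c1 y) (cu x - cu y) (cv x - cv y)"

definition scaleR_tnum :: "real \<Rightarrow> tnum \<Rightarrow> tnum"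
  where "r *\<^sub>R x = TNum (r * c1 x) (r * cu x) (r * cv x)"

instance
  by standard
    (simp_all add: tnum_eq_iff zero_tnum_def plus_tnum_def uminus_tnum_def minus_tnum_def
      scaleR_tnum_def algebra_simps)

end

instantiation tnum :: "{comm_ring_1, real_algebra_1}"
begin

definition one_tnum :: tnum
  where "1 = TNum 1 0 0"

definition times_tnum :: "tnum \<Rightarrow> tnum \<Rightarrow> tnum"
  where "x * y =
    TNum (c1 x * c1 y - cu x * cv y - cv x * cu y)
         (c1 x * cu y + cu x * c1 y - cv x * cv y)
         (c1 x * cv y + cu x * cu y + cv x * c1 y)"

instance
  by standard
    (simp_all add: tnum_eq_iff zero_tnum_def one_tnum_def plus_tnum_def times_tnum_def
      scaleR_tnum_def algebra_simps)

end

definition A_form :: "tnum \<Rightarrow> real"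
  where "A_form x = (c1 x)\<^sup>2 + (cu x)\<^sup>2 + (cv x)\<^sup>2"

definition B_form :: "tnum \<Rightarrow> real"
  where "B_form x = c1 x * cu x + cu x * cv x - cv x * c1 x"

definition D_set :: "tnum set"
  where "D_set = {x. A_form x + B_form x = 0}"

definition G_set :: "tnum set"
  where "G_set = {TNum (\<alpha> - \<beta>) \<alpha> \<beta> | \<alpha> \<beta>. True}"

definition annihilator :: "'a::real_algebra set \<Rightarrow> 'a set"
  where "annihilator S = {a. \<forall>s\<in>S. a * s = 0}"

text \<open>With this convention \<open>0\<close> is a zero divisor in every nonzero algebra.\<close>

definition zero_divisor :: "'a::real_algebra \<Rightarrow> bool"
  where "zero_divisor y \<longleftrightarrow> (\<exists>z. z \<noteq> 0 \<and> y * z = 0)"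

end

theory Submission
  imports Defs
begin

text \<open>
  \<open>\<bbbT>\<close> is \<open>\<real>[u]/(u\<^sup>3 + 1)\<close> with \<open>v = u\<^sup>2\<close>, and \<open>u\<^sup>3 + 1 = (u + 1)(u\<^sup>2 - u + 1)\<close>. So \<open>\<bbbT>\<close> is the
  direct sum of the ideals generated by the two factors: \<open>G_set\<close>, the kernel of evaluation at
  \<open>u = -1\<close>, and \<open>D_set\<close>, the kernel of evaluation at a root of \<open>u\<^sup>2 - u + 1\<close>, whose squared modulus
  is \<open>A_form + B_form\<close>. An element is a unit iff both evaluations are nonzero.
\<close>

lemmas tnum_defs = tnum_eq_iff zero_tnum_def one_tnum_def plus_tnum_def times_tnum_def
  scaleR_tnum_def

text \<open>A sum of real squares vanishes only if each square does, so this turns the quadratic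
  condition in \<open>D_set\<close> into linear equations.\<close>

lemma twice_A_plus_B:
  "2 * (A_form x + B_form x) = (c1 x + cu x)\<^sup>2 + (cu x + cv x)\<^sup>2 + (cv x - c1 x)\<^sup>2"
  by (simp add: A_form_def B_form_def power2_eq_square algebra_simps)

lemma D_set_iff: "x \<in> D_set \<longleftrightarrow> cu x = - c1 x \<and> cv x = c1 x"
proof -
  have "x \<in> D_set \<longleftrightarrow> (c1 x + cu x)\<^sup>2 + (cu x + cv x)\<^sup>2 + (cv x - c1 x)\<^sup>2 = 0"
    \<comment> \<open>Kept undistributed, \<open>2 * (A_form x + B_form x) = 0\<close> is a product
      from which the factor 2 cancels.\<close>
    unfolding D_set_def twice_A_plus_B[symmetric] by (simp del: distrib_left_numeral)
  also have "\<dots> \<longleftrightarrow> c1 x + cu x = 0 \<and> cu x + cv x = 0 \<and> cv x - c1 x = 0"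
    by (simp add: add_nonneg_eq_0_iff)
  also have "\<dots> \<longleftrightarrow> cu x = - c1 x \<and> cv x = c1 x"
    by argo
  finally show ?thesis .
qed

lemma G_set_iff: "x \<in> G_set \<longleftrightarrow> c1 x = cu x - cv x"
  by (cases x) (auto simp: G_set_def)

lemma D_set_mult_G_set:
  assumes "x \<in> D_set" "y \<in> G_set"
  shows "x * y = 0" "y * x = 0"
proof -
  show "x * y = 0"
    using assms by (simp add: D_set_iff G_set_iff tnum_defs) (simp add: algebra_simps)
  then show "y * x = 0"
    by (simp add: mult.commute)
qed

lemma annihilator_D_set: "annihilator D_set = G_set"
proof
  show "annihilator D_set \<subseteq> G_set"
  proof
    fix x assume "x \<in> annihilator D_set"
    \<comment> \<open>The witness 1 - u + v generates \<open>D_set\<close>; multiplying it by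
      \<open>x\<close> scales it by \<open>c1 x - cu x + cv x\<close>.\<close>
    moreover have "TNum 1 (- 1) 1 \<in> D_set"
      by (simp add: D_set_iff)
    ultimately have "x * TNum 1 (- 1) 1 = 0"
      by (simp add: annihilator_def)
    then show "x \<in> G_set"
      by (simp add: G_set_iff tnum_defs)
  qed
  show "G_set \<subseteq> annihilator D_set"
    using D_set_mult_G_set by (auto simp: annihilator_def)
qed

lemma annihilator_G_set: "annihilator G_set = D_set"
proof
  show "annihilator G_set \<subseteq> D_set"
  proof
    fix x assume "x \<in> annihilator G_set"
    \<comment> \<open>The witness 1 + u generates \<open>G_set\<close>; its product with
      \<open>x\<close> has as coordinates, up to sign, the linear forms of
      \<open>twice_A_plus_B\<close>.\<close>
    moreover have "TNum 1 1 0 \<in> G_set"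
      by (simp add: G_set_iff)
    ultimately have "x * TNum 1 1 0 = 0"
      by (simp add: annihilator_def)
    then show "x \<in> D_set"
      by (simp add: D_set_iff tnum_defs)
  qed
  show "D_set \<subseteq> annihilator G_set"
    using D_set_mult_G_set by (auto simp: annihilator_def)
qed

text \<open>The second factor is the first column of the adjugate of the matrix of multiplication by \<open>x\<close>.\<close>

lemma mult_adjugate:
  "x * TNum ((c1 x)\<^sup>2 + cu x * cv x) (- (cv x)\<^sup>2 - c1 x * cu x) ((cu x)\<^sup>2 - c1 x * cv x)
    = ((c1 x - cu x + cv x) * (A_form x + B_form x)) *\<^sub>R 1"
  by (simp add: tnum_defs A_form_def B_form_def power2_eq_square algebra_simps)

lemma unit_if_notin_D_set_G_set:
  assumes "x \<notin> D_set" "x \<notin> G_set"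
  shows "x dvd 1"
proof -
  \<comment> \<open>\<open>d\<close> is the determinant of multiplication by \<open>x\<close>; each
    factor vanishes on just one of the two ideals.\<close>
  define d where "d = (c1 x - cu x + cv x) * (A_form x + B_form x)"
  obtain y where y: "x * y = d *\<^sub>R 1"
    using mult_adjugate unfolding d_def by blast
  have "d \<noteq> 0"
    using assms by (auto simp: d_def D_set_def G_set_iff)
  then have "x * (inverse d *\<^sub>R y) = 1"
    by (simp add: y)
  then show ?thesis
    by (metis dvdI)
qed

lemma zero_divisor_not_unit:
  fixes x :: "'a::{comm_ring_1, real_algebra_1}"
  assumes "zero_divisor x"
  shows "\<not> x dvd 1"
proof
  assume "x dvd 1"
  then obtain y where "1 = x * y" ..
  moreover obtain z where "z \<noteq> 0" "x * z = 0"
    using assms by (auto simp: zero_divisor_def)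
  ultimately show False
    by (metis mult.assoc mult.commute mult_1 mult_zero_right)
qed

lemma zero_divisor_if_in_D_set_G_set:
  assumes "x \<in> D_set \<or> x \<in> G_set"
  shows "zero_divisor x"
  using assms
proof
  assume "x \<in> D_set"
  then have "x * TNum 1 1 0 = 0"
    by (simp add: D_set_mult_G_set G_set_iff)
  then show ?thesis
    unfolding zero_divisor_def by (intro exI[of _ "TNum 1 1 0"]) (simp add: zero_tnum_def)
next
  assume "x \<in> G_set"
  then have "x * TNum 1 (- 1) 1 = 0"
    by (simp add: D_set_mult_G_set D_set_iff)
  then show ?thesis
    unfolding zero_divisor_def by (intro exI[of _ "TNum 1 (- 1) 1"]) (simp add: zero_tnum_def)
qed

text \<open>The three facts used form a cycle of implications, which yields \<open>unit_iff\<close>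
  as well.\<close>

lemma zero_divisor_iff: "zero_divisor x \<longleftrightarrow> x \<in> D_set \<or> x \<in> G_set"
  using unit_if_notin_D_set_G_set zero_divisor_not_unit zero_divisor_if_in_D_set_G_set by metis

lemma unit_iff: "x dvd 1 \<longleftrightarrow> x \<notin> D_set \<and> x \<notin> G_set"
  using unit_if_notin_D_set_G_set zero_divisor_not_unit zero_divisor_if_in_D_set_G_set by metis

text \<open>The first two vectors span \<open>G_set\<close>, the third \<open>D_set\<close>.
  Evaluation at u = -1 kills the former and sends the latter to 3, which determines
  \<open>c\<close>.\<close>

lemma ideal_coordinates_iff:
  "x = a *\<^sub>R TNum 1 1 0 + b *\<^sub>R TNum (- 1) 0 1 + c *\<^sub>R TNum 1 (- 1) 1 \<longleftrightarrow>
    c = (c1 x - cu x + cv x) / 3 \<and> a = cu x + c \<and> b = cv x - c"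
  by (simp add: tnum_defs) argo

lemma unit_iff_ideal_coordinates:
  "x dvd 1 \<longleftrightarrow>
    (\<exists>a b c :: real.
      x = a *\<^sub>R TNum 1 1 0 + b *\<^sub>R TNum (- 1) 0 1 + c *\<^sub>R TNum 1 (- 1) 1
      \<and> a\<^sup>2 + b\<^sup>2 > 0 \<and> c\<^sup>2 > 0)"
proof -
  define c where "c = (c1 x - cu x + cv x) / 3"
  \<comment> \<open>The two expressions are the coordinates \<open>a\<close> and \<open>b\<close> of
    the \<open>G_set\<close> component of \<open>x\<close>.\<close>
  have D: "x \<in> D_set \<longleftrightarrow> cu x + c = 0 \<and> cv x - c = 0"
    unfolding D_set_iff c_def by argo
  have G: "x \<in> G_set \<longleftrightarrow> c = 0"
    by (auto simp: G_set_iff c_def)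
  have "x dvd 1 \<longleftrightarrow> (cu x + c)\<^sup>2 + (cv x - c)\<^sup>2 > 0 \<and> c\<^sup>2 > 0"
    unfolding unit_iff D G by (simp add: sum_power2_gt_zero_iff)
  then show ?thesis
    \<comment> \<open>Uniqueness of the coordinates eliminates the quantifiers.\<close>
    unfolding ideal_coordinates_iff c_def[symmetric] by simp
qed

theorem mainTheorem4:
  shows "(annihilator D_set = G_set \<and> annihilator G_set = D_set)
    \<and> (\<forall>y::tnum. zero_divisor y \<longleftrightarrow> y \<in> D_set \<or> y \<in> G_set)
    \<and> (\<forall>x::tnum. x dvd 1 \<longleftrightarrow>
         (\<exists>a b c :: real.
            x = a *\<^sub>R TNum 1 1 0 + b *\<^sub>R TNum (-1) 0 1 + c *\<^sub>R TNum 1 (-1) 1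
            \<and> a\<^sup>2 + b\<^sup>2 > 0 \<and> c\<^sup>2 > 0))"
  by (intro conjI allI annihilator_D_set annihilator_G_set zero_divisor_iff
      unit_iff_ideal_coordinates)

end
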